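(* There exists a Tychonoff space that is ccc-tight but not Lindelöf-tight.
   Context: For a property $\mathcal{P}$ that a subspace of a topological space may have, a space $X$ is called $\mathcal{P}$-tight if for all $x\in X$ and $A\subseteq X$ with $x\in\overline{A}$ there is $B\subseteq A$ such that $x\in\overline{B}$ and $B$ has property $\mathcal{P}$. ccc-tight is $\mathcal{P}$-tight for $\mathcal{P}$ = "satisfies the countable chain condition in the subspace topology" (every pairwise disjoint family of nonempty relatively open subsets is countable); Lindelöf-tight is $\mathcal{P}$-tight for $\mathcal{P}$ = "Lindelöf in the subspace topology". *)

theory Defs
  imports "HOL-Analysis.Analysis"
begin

definition ccc_space :: "'a topology \<Rightarrow> bool" where
  "ccc_space X \<longleftrightarrow>
     (\<forall>\<U>. (\<forall>U\<in>\<U>. openin X U \<and> U \<noteq> {}) \<and> pairwise disjnt \<U> \<longrightarrow> countable \<U>)"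

(* P is a property of spaces; a subset B has it when its subspace topology does. *)
definition tight :: "('a topology \<Rightarrow> bool) \<Rightarrow> 'a topology \<Rightarrow> bool" where
  "tight P X \<longleftrightarrow>
     (\<forall>x A. x \<in> topspace X \<and> A \<subseteq> topspace X \<and> x \<in> X closure_of A \<longrightarrow>
        (\<exists>B. B \<subseteq> A \<and> x \<in> X closure_of B \<and> P (subtopology X B)))"

abbreviation ccc_tight :: "'a topology \<Rightarrow> bool" where
  "ccc_tight \<equiv> tight ccc_space"

abbreviation Lindelof_tight :: "'a topology \<Rightarrow> bool" where
  "Lindelof_tight \<equiv> tight Lindelof_space"

definition Tychonoff_space :: "'a topology \<Rightarrow> bool" where
  "Tychonoff_space X \<longleftrightarrow> completely_regular_space X \<and> Hausdorff_space X"

end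

theory Submission
  imports Defs
begin

text \<open>
  Let \<open>Z\<close> be a zero-dimensional, countably tight ccc space in which Lindelof subspaces are nowhere
  dense, and adjoin to \<open>Z\<close> a remote point \<open>p\<close>, i.e. one that is in the closure of no nowhere dense
  set. If \<open>p\<close> is in the closure of \<open>A\<close>, it remains so for \<open>B = A \<inter> interior (closure A)\<close>, since \<open>A - B\<close>
  is nowhere dense; and \<open>B\<close> is ccc because it is dense in an open subset of \<open>Z\<close>. But \<open>p\<close> is not in the
  closure of any Lindelof subset of \<open>Z\<close>.

  For \<open>Z\<close> take countably many copies of the Pixley-Roy space of the Cantor set. It is first countable
  and ccc, and its Lindelof subspaces are countable, hence nowhere dense. Neighbourhoods of \<open>p\<close> come
  from van Douwen's method: every dense open \<open>D\<close> has, in copy \<open>n\<close>, a clopen subset \<open>G n D\<close> such that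
  any \<open>n\<close> of the sets \<open>G n D\<close> intersect. The method normally needs a countable pi-base; here
  compactness of the Cantor set replaces it.
\<close>

section \<open>The countable chain condition and tightness\<close>

lemma ccc_space_disjoint_family:
  assumes X: "ccc_space X" and op: "\<And>i. i \<in> I \<Longrightarrow> openin X (h i) \<and> h i \<noteq> {}"
    and dj: "\<And>i j. \<lbrakk>i \<in> I; j \<in> I; i \<noteq> j\<rbrakk> \<Longrightarrow> disjnt (h i) (h j)"
  shows "countable I"
proof -
  have "inj_on h I"
    using op dj by (intro inj_onI) (metis disjnt_self_iff_empty)
  moreover have "pairwise disjnt (h ` I)"
    using dj by (auto simp: pairwise_def)
  then have "countable (h ` I)"
    using X op unfolding ccc_space_def by (metis imageE)
  ultimately show ?thesis using countable_image_inj_on by blast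
qed

lemma ccc_space_continuous_map_image:
  assumes X: "ccc_space X" and f: "continuous_map X Y f" "f ` topspace X = topspace Y"
  shows "ccc_space Y"
  unfolding ccc_space_def
proof (intro allI impI)
  fix \<U> assume U: "(\<forall>U\<in>\<U>. openin Y U \<and> U \<noteq> {}) \<and> pairwise disjnt \<U>"
  show "countable \<U>"
  proof (rule ccc_space_disjoint_family[OF X])
    fix U assume "U \<in> \<U>"
    then have V: "openin Y U" "U \<noteq> {}" using U by simp_all
    then have "openin X {x \<in> topspace X. f x \<in> U}"
      using openin_continuous_map_preimage[OF f(1)] by blast
    moreover have "{x \<in> topspace X. f x \<in> U} \<noteq> {}"
      using V openin_subset[OF V(1)] unfolding f(2)[symmetric] by blast
    ultimately show "openin X {x \<in> topspace X. f x \<in> U} \<and> {x \<in> topspace X. f x \<in> U} \<noteq> {}"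
      by blast
  next
    fix U V assume "U \<in> \<U>" "V \<in> \<U>" "U \<noteq> V"
    then have "disjnt U V" using U by (simp add: pairwise_def)
    then show "disjnt {x \<in> topspace X. f x \<in> U} {x \<in> topspace X. f x \<in> V}"
      by (auto simp: disjnt_iff)
  qed
qed

text \<open>Relatively open sets extend to open subsets of \<open>W\<close>. The extensions stay
  disjoint: an overlap inside the closure of \<open>B\<close> would contain a point of
  \<open>B\<close> common to both original sets.\<close>

lemma ccc_space_dense_in_open:
  assumes X: "ccc_space X" and W: "openin X W" "B \<subseteq> W" "W \<subseteq> X closure_of B"
  shows "ccc_space (subtopology X B)"
  unfolding ccc_space_def
proof (intro allI impI)
  fix \<U> assume U: "(\<forall>U\<in>\<U>. openin (subtopology X B) U \<and> U \<noteq> {}) \<and> pairwise disjnt \<U>"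
  then have "\<forall>U\<in>\<U>. \<exists>V. openin X V \<and> U = V \<inter> B"
    by (simp add: openin_subtopology)
  then obtain V where V: "\<And>U. U \<in> \<U> \<Longrightarrow> openin X (V U)" "\<And>U. U \<in> \<U> \<Longrightarrow> V U \<inter> B = U"
    by metis
  show "countable \<U>"
  proof (rule ccc_space_disjoint_family[OF X])
    fix U assume "U \<in> \<U>"
    then have "openin X (V U)" "U \<noteq> {}" "U \<subseteq> V U \<inter> W"
      using V(1) U V(2)[of U] W(2) by auto
    then show "openin X (V U \<inter> W) \<and> V U \<inter> W \<noteq> {}"
      using W(1) by blast
  next
    fix U U' assume UU': "U \<in> \<U>" "U' \<in> \<U>" "U \<noteq> U'"
    show "disjnt (V U \<inter> W) (V U' \<inter> W)"
    proof (rule ccontr)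
      assume "\<not> disjnt (V U \<inter> W) (V U' \<inter> W)"
      then obtain x where x: "x \<in> V U \<inter> V U'" "x \<in> X closure_of B"
        using W(3) by (auto simp: disjnt_iff)
      moreover have "openin X (V U \<inter> V U')" using V(1) UU' by blast
      ultimately obtain b where "b \<in> B" "b \<in> V U \<inter> V U'"
        unfolding in_closure_of by blast
      then have "b \<in> U" "b \<in> U'" using V(2) UU' by blast+
      moreover have "disjnt U U'" using U UU' by (simp add: pairwise_def)
      ultimately show False by (simp add: disjnt_iff)
    qed
  qed
qed

lemma countable_topspace_imp_ccc_space:
  assumes "countable (topspace X)"
  shows "ccc_space X"
  unfolding ccc_space_def
proof (intro allI impI)
  fix \<U> assume U: "(\<forall>U\<in>\<U>. openin X U \<and> U \<noteq> {}) \<and> pairwise disjnt \<U>"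
  have ch: "(SOME x. x \<in> U) \<in> U" if "U \<in> \<U>" for U
    using U that by (simp add: some_in_eq)
  have "inj_on (\<lambda>U. SOME x. x \<in> U) \<U>"
  proof (rule inj_onI)
    fix U V assume UV: "U \<in> \<U>" "V \<in> \<U>" "(SOME x. x \<in> U) = (SOME x. x \<in> V)"
    then have "\<not> disjnt U V" using ch[of U] ch[of V] by (metis disjnt_iff)
    then show "U = V" using U UV by (auto simp: pairwise_def)
  qed
  moreover have "(\<lambda>U. SOME x. x \<in> U) ` \<U> \<subseteq> topspace X"
    using ch U openin_subset by blast
  ultimately show "countable \<U>"
    using assms by (metis countable_image_inj_on countable_subset)
qed

text \<open>For clopen \<open>V\<close>, the function that is 0 on \<open>V\<close> and 1 elsewhere
  is continuous; it separates a point of \<open>V\<close> from any closed set missing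
  \<open>V\<close>.\<close>

lemma completely_regular_space_clopen_base:
  assumes "\<And>U x. openin X U \<Longrightarrow> x \<in> U \<Longrightarrow> \<exists>V. openin X V \<and> closedin X V \<and> x \<in> V \<and> V \<subseteq> U"
  shows "completely_regular_space X"
  unfolding completely_regular_space_def
proof (intro allI impI)
  fix S x assume S: "closedin X S \<and> x \<in> topspace X - S"
  then obtain V where V: "openin X V" "closedin X V" "x \<in> V" "V \<subseteq> topspace X - S"
    using assms[of "topspace X - S" x] by blast
  define f :: "'a \<Rightarrow> real" where "f y = (if y \<in> V then 0 else 1)" for y
  have "openin X {y \<in> topspace X. f y \<in> T}" for T
  proof -
    have "{y \<in> topspace X. f y \<in> T} =
        (if 0 \<in> T then V else {}) \<union> (if 1 \<in> T then topspace X - V else {})"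
      using openin_subset[OF V(1)] by (auto simp: f_def)
    then show ?thesis using V(1,2) by auto
  qed
  then have "continuous_map X (top_of_set {0..1}) f"
    by (auto simp: continuous_map_def openin_subtopology f_def)
  moreover have "f x = 0" "f ` S \<subseteq> {1}" using V by (auto simp: f_def)
  ultimately show "\<exists>f. continuous_map X (top_of_set {0..1::real}) f \<and> f x = 0 \<and> f ` S \<subseteq> {1}"
    by blast
qed

section \<open>Transfer of tightness to homeomorphic copies on another type\<close>

lemma tight_homeomorphic:
  assumes X: "tight P X" and hom: "homeomorphic_map X Y f"
    and P: "\<And>B. B \<subseteq> topspace X \<Longrightarrow> P (subtopology X B) \<Longrightarrow> Q (subtopology Y (f ` B))"
  shows "tight Q Y"
  unfolding tight_def
proof (intro allI impI)
  fix y A assume y: "y \<in> topspace Y \<and> A \<subseteq> topspace Y \<and> y \<in> Y closure_of A"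
  have im: "f ` topspace X = topspace Y" using hom by (rule homeomorphic_imp_surjective_map)
  obtain A' where A': "A' \<subseteq> topspace X" "A = f ` A'"
    using y im by (metis subset_imageE)
  then obtain x where x: "x \<in> X closure_of A'" "y = f x"
    using y homeomorphic_map_closure_of[OF hom A'(1)] by auto
  moreover have "x \<in> topspace X" using x by (simp add: in_closure_of)
  ultimately obtain B where B: "B \<subseteq> A'" "x \<in> X closure_of B" "P (subtopology X B)"
    using X A'(1) unfolding tight_def by blast
  then have "f ` B \<subseteq> A" "y \<in> Y closure_of (f ` B)" "Q (subtopology Y (f ` B))"
    using A' x P[of B] homeomorphic_map_closure_of[OF hom, of B] by auto
  then show "\<exists>B\<subseteq>A. y \<in> Y closure_of B \<and> Q (subtopology Y B)" by blast
qed

lemma homeomorphic_map_subtopology_image: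
  assumes "homeomorphic_map X Y f" "B \<subseteq> topspace X"
  shows "homeomorphic_map (subtopology X B) (subtopology Y (f ` B)) f"
  using assms by (intro homeomorphic_map_subtopologies)
    (auto simp: homeomorphic_eq_everything_map)

text \<open>The topology is pushed forward by declaring images of open sets open. Injectivity lets
  images commute with intersections, as a topology requires.\<close>

lemma ex_homeomorphic_map_inj_on:
  assumes "inj_on f (topspace X)"
  shows "\<exists>Y. homeomorphic_map X Y f"
proof -
  define Y where "Y = topology (\<lambda>V. \<exists>U. openin X U \<and> V = f ` U)"
  have "istopology (\<lambda>V. \<exists>U. openin X U \<and> V = f ` U)"
    unfolding istopology_def
  proof (intro conjI allI impI)
    fix S T assume "\<exists>U. openin X U \<and> S = f ` U" "\<exists>U. openin X U \<and> T = f ` U"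
    then obtain U V where UV: "openin X U" "S = f ` U" "openin X V" "T = f ` V" by blast
    then have "S \<inter> T = f ` (U \<inter> V)"
      using inj_on_image_Int[OF assms, of U V] by (simp add: openin_subset)
    then show "\<exists>U. openin X U \<and> S \<inter> T = f ` U" using UV by blast
  next
    fix \<K> assume "\<forall>K\<in>\<K>. \<exists>U. openin X U \<and> K = f ` U"
    then obtain u where u: "\<And>K. K \<in> \<K> \<Longrightarrow> openin X (u K) \<and> K = f ` u K" by metis
    then have "\<Union>\<K> = f ` (\<Union>K\<in>\<K>. u K)" by (auto simp: image_UN)
    moreover have "openin X (\<Union>K\<in>\<K>. u K)" using u by auto
    ultimately show "\<exists>U. openin X U \<and> \<Union>\<K> = f ` U" by blast
  qed
  then have Y: "openin Y V \<longleftrightarrow> (\<exists>U. openin X U \<and> V = f ` U)" for V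
    by (simp add: Y_def topology_inverse')
  have top: "topspace Y = f ` topspace X"
  proof
    show "topspace Y \<subseteq> f ` topspace X"
      using openin_topspace[of Y] unfolding Y using openin_subset by blast
    show "f ` topspace X \<subseteq> topspace Y"
      by (rule openin_subset) (auto simp: Y)
  qed
  have "homeomorphic_map X Y f"
  proof (rule bijective_open_imp_homeomorphic_map)
    show "continuous_map X Y f"
      unfolding continuous_map_def
    proof (intro conjI allI impI)
      show "f \<in> topspace X \<rightarrow> topspace Y" using top by auto
      fix V assume "openin Y V"
      then obtain U where U: "openin X U" "V = f ` U" using Y by blast
      then have "{x \<in> topspace X. f x \<in> V} = U"
        using assms openin_subset[OF U(1)] by (auto simp: inj_on_def)
      then show "openin X {x \<in> topspace X. f x \<in> V}" using U(1) by simp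
    qed
    show "open_map X Y f" by (auto simp: open_map_def Y)
  qed (use top assms in auto)
  then show ?thesis by blast
qed

text \<open>Serves to carry the example to the type fixed in the theorem. ccc-tightness travels
  along \<open>e\<close>; Lindelof-tightness would travel back along the inverse and is refuted
  there.\<close>

lemma ex_space_on_larger_type:
  fixes X :: "'a topology" and e :: "'a \<Rightarrow> 'b"
  assumes "inj e" "Tychonoff_space X" "ccc_tight X" "\<not> Lindelof_tight X"
  shows "\<exists>Y :: 'b topology. Tychonoff_space Y \<and> ccc_tight Y \<and> \<not> Lindelof_tight Y"
proof -
  obtain Y where Y: "homeomorphic_map X Y e"
    using ex_homeomorphic_map_inj_on[of e X] assms(1) by (auto intro: inj_on_subset)
  then have XY: "X homeomorphic_space Y" by (rule homeomorphic_map_imp_homeomorphic_space)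
  obtain g where g: "homeomorphic_maps X Y e g"
    using Y homeomorphic_map_maps by blast
  then have g': "homeomorphic_map Y X g"
    using homeomorphic_maps_map by blast
  have "Tychonoff_space Y"
    using assms(2) homeomorphic_completely_regular_space[OF XY] homeomorphic_Hausdorff_space[OF XY]
    by (simp add: Tychonoff_space_def)
  moreover have "ccc_tight Y"
  proof (rule tight_homeomorphic[OF _ Y])
    show "ccc_tight X" by fact
    fix B assume "B \<subseteq> topspace X" "ccc_space (subtopology X B)"
    moreover note homeomorphic_map_subtopology_image[OF Y this(1)]
    ultimately show "ccc_space (subtopology Y (e ` B))"
      by (meson ccc_space_continuous_map_image homeomorphic_imp_continuous_map
          homeomorphic_imp_surjective_map)
  qed
  moreover have "\<not> Lindelof_tight Y"
  proof
    assume "Lindelof_tight Y"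
    then have "Lindelof_tight X"
    proof (rule tight_homeomorphic[OF _ g'])
      fix B assume "B \<subseteq> topspace Y" "Lindelof_space (subtopology Y B)"
      moreover note homeomorphic_map_subtopology_image[OF g' this(1)]
      ultimately show "Lindelof_space (subtopology X (g ` B))"
        by (meson Lindelof_space_continuous_map_image homeomorphic_imp_continuous_map
            homeomorphic_imp_surjective_map)
    qed
    then show False using assms(4) by blast
  qed
  ultimately show ?thesis by blast
qed

section \<open>Adjoining a remote point\<close>

text \<open>The interior in question lies inside the interior of the closure of \<open>A\<close>,
  which is exactly what was removed. So it is an open set missing a set whose closure contains
  it.\<close>

lemma nowhere_dense_Diff:
  "X interior_of (X closure_of (A - X interior_of (X closure_of A))) = {}"
    (is "?T = {}")
proof -
  have "?T \<subseteq> X interior_of (X closure_of A)"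
    by (intro interior_of_mono closure_of_mono) auto
  then have "?T \<inter> (A - X interior_of (X closure_of A)) = {}" by blast
  then have "?T \<inter> X closure_of (A - X interior_of (X closure_of A)) = {}"
    by (simp add: openin_Int_closure_of_eq_empty)
  then show ?thesis
    using interior_of_subset[of X "X closure_of (A - X interior_of (X closure_of A))"] by blast
qed

text \<open>\<open>None\<close> is the adjoined point; the members of \<open>\<G>\<close> are meant
  as the traces on \<open>Z\<close> of its basic neighbourhoods.\<close>

definition one_point_extension :: "'a topology \<Rightarrow> 'a set set \<Rightarrow> 'a option topology" where
  "one_point_extension Z \<G> =
     topology (\<lambda>U. openin Z (Some -` U) \<and> (None \<in> U \<longrightarrow> (\<exists>g\<in>\<G>. g \<subseteq> Some -` U)))"

text \<open>\<open>remote\<close> expresses remoteness by dense open sets, the complements of closed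
  nowhere dense ones. \<open>crowded\<close> makes singletons nowhere dense, so that the new point
  is separated from every point of \<open>Z\<close>.\<close>

locale clopen_filter_base =
  fixes Z :: "'a topology" and \<G> :: "'a set set"
  assumes clopen_base: "\<lbrakk>openin Z U; x \<in> U\<rbrakk> \<Longrightarrow> \<exists>V. openin Z V \<and> closedin Z V \<and> x \<in> V \<and> V \<subseteq> U"
    and Hausdorff: "Hausdorff_space Z"
    and nonempty: "\<G> \<noteq> {}"
    and Int_closed: "\<lbrakk>g \<in> \<G>; h \<in> \<G>\<rbrakk> \<Longrightarrow> g \<inter> h \<in> \<G>"
    and clopen: "g \<in> \<G> \<Longrightarrow> openin Z g \<and> closedin Z g \<and> g \<noteq> {}"
    and remote: "\<lbrakk>openin Z D; Z closure_of D = topspace Z\<rbrakk> \<Longrightarrow> \<exists>g\<in>\<G>. g \<subseteq> D"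
    and crowded: "x \<in> topspace Z \<Longrightarrow> \<not> openin Z {x}"
begin

abbreviation "X \<equiv> one_point_extension Z \<G>"

lemma openin_ext:
  "openin X U \<longleftrightarrow> openin Z (Some -` U) \<and> (None \<in> U \<longrightarrow> (\<exists>g\<in>\<G>. g \<subseteq> Some -` U))"
proof -
  have "istopology (\<lambda>U. openin Z (Some -` U) \<and> (None \<in> U \<longrightarrow> (\<exists>g\<in>\<G>. g \<subseteq> Some -` U)))"
    unfolding istopology_def
  proof (intro conjI allI impI)
    fix S T
    assume S: "openin Z (Some -` S) \<and> (None \<in> S \<longrightarrow> (\<exists>g\<in>\<G>. g \<subseteq> Some -` S))"
      and T: "openin Z (Some -` T) \<and> (None \<in> T \<longrightarrow> (\<exists>g\<in>\<G>. g \<subseteq> Some -` T))"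
    then show "openin Z (Some -` (S \<inter> T))" by (simp add: vimage_Int openin_Int)
    assume "None \<in> S \<inter> T"
    then obtain g h where "g \<in> \<G>" "g \<subseteq> Some -` S" "h \<in> \<G>" "h \<subseteq> Some -` T" using S T by blast
    then show "\<exists>g\<in>\<G>. g \<subseteq> Some -` (S \<inter> T)"
      using Int_closed[of g h] by (intro bexI[of _ "g \<inter> h"]) auto
  next
    fix \<K> assume K: "\<forall>K\<in>\<K>. openin Z (Some -` K) \<and> (None \<in> K \<longrightarrow> (\<exists>g\<in>\<G>. g \<subseteq> Some -` K))"
    then show "openin Z (Some -` \<Union>\<K>)" by (auto simp: vimage_Union)
    assume "None \<in> \<Union>\<K>"
    then obtain K where "K \<in> \<K>" "None \<in> K" by blast
    then obtain g where "g \<in> \<G>" "g \<subseteq> Some -` K" using K by blast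
    then show "\<exists>g\<in>\<G>. g \<subseteq> Some -` \<Union>\<K>"
      using \<open>K \<in> \<K>\<close> by (intro bexI[of _ g]) auto
  qed
  then show ?thesis
    by (simp add: one_point_extension_def topology_inverse')
qed

lemma topspace_ext: "topspace X = insert None (Some ` topspace Z)"
proof
  have "Some -` topspace X \<subseteq> topspace Z"
    using openin_topspace[of X] unfolding openin_ext by (auto dest: openin_subset)
  then show "topspace X \<subseteq> insert None (Some ` topspace Z)"
    by (auto simp: subset_iff image_iff) (metis not_Some_eq)
  have *: "Some -` insert None (Some ` topspace Z) = topspace Z" by auto
  obtain g where "g \<in> \<G>" "g \<subseteq> topspace Z" using nonempty clopen openin_subset by blast
  then have "openin X (insert None (Some ` topspace Z))" unfolding openin_ext * by auto
  then show "insert None (Some ` topspace Z) \<subseteq> topspace X" by (rule openin_subset)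
qed

lemma openin_ext_image_Some: "openin X (Some ` U) \<longleftrightarrow> openin Z U"
  by (auto simp: openin_ext inj_vimage_image_eq)

text \<open>\<open>Z\<close> is embedded as an open subspace, so closures at its points depend only
  on traces on \<open>Z\<close>.\<close>

lemma in_closure_of_ext_Some:
  assumes "A \<subseteq> topspace X"
  shows "Some x \<in> X closure_of A \<longleftrightarrow> x \<in> Z closure_of (Some -` A)"
proof
  assume "Some x \<in> X closure_of A"
  then have x: "x \<in> topspace Z" "\<And>U. \<lbrakk>Some x \<in> U; openin X U\<rbrakk> \<Longrightarrow> \<exists>y\<in>A. y \<in> U"
    by (auto simp: in_closure_of topspace_ext)
  have "\<exists>y. y \<in> Some -` A \<and> y \<in> T" if "x \<in> T" "openin Z T" for T
    using x(2)[of "Some ` T"] that openin_ext_image_Some by auto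
  then show "x \<in> Z closure_of (Some -` A)" using x(1) by (auto simp: in_closure_of)
next
  assume "x \<in> Z closure_of (Some -` A)"
  then have x: "x \<in> topspace Z" "\<And>U. \<lbrakk>x \<in> U; openin Z U\<rbrakk> \<Longrightarrow> \<exists>y. y \<in> Some -` A \<and> y \<in> U"
    by (auto simp: in_closure_of)
  have "\<exists>y. y \<in> A \<and> y \<in> T" if "Some x \<in> T" "openin X T" for T
    using x(2)[of "Some -` T"] that by (auto simp: openin_ext)
  then show "Some x \<in> X closure_of A" using x(1) by (auto simp: in_closure_of topspace_ext)
qed

lemma in_closure_of_ext_None:
  "None \<in> X closure_of (Some ` A) \<longleftrightarrow> (\<forall>g\<in>\<G>. g \<inter> A \<noteq> {})"
proof
  assume *: "None \<in> X closure_of (Some ` A)"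
  show "\<forall>g\<in>\<G>. g \<inter> A \<noteq> {}"
  proof
    fix g assume g: "g \<in> \<G>"
    have "Some -` insert None (Some ` g) = g" by auto
    then have "openin X (insert None (Some ` g))"
      using g clopen by (auto simp: openin_ext)
    then obtain y where "y \<in> Some ` A" "y \<in> insert None (Some ` g)"
      using * unfolding in_closure_of by blast
    then show "g \<inter> A \<noteq> {}" by auto
  qed
next
  assume *: "\<forall>g\<in>\<G>. g \<inter> A \<noteq> {}"
  have "\<exists>y. y \<in> Some ` A \<and> y \<in> T" if T: "None \<in> T" "openin X T" for T
  proof -
    obtain g where "g \<in> \<G>" "g \<subseteq> Some -` T" using T by (auto simp: openin_ext)
    then show ?thesis using * by blast
  qed
  then show "None \<in> X closure_of (Some ` A)" by (auto simp: in_closure_of topspace_ext)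
qed

lemma homeomorphic_map_Some:
  assumes "B \<subseteq> topspace Z"
  shows "homeomorphic_map (subtopology Z B) (subtopology X (Some ` B)) Some"
proof (rule bijective_open_imp_homeomorphic_map)
  show "continuous_map (subtopology Z B) (subtopology X (Some ` B)) Some"
  proof -
    have "{x \<in> topspace Z. Some x \<in> U} = topspace Z \<inter> Some -` U" for U by auto
    then have "continuous_map Z X Some"
      by (auto simp: continuous_map_def openin_ext topspace_ext)
    then show ?thesis
      by (auto simp: continuous_map_in_subtopology continuous_map_from_subtopology)
  qed
  show "open_map (subtopology Z B) (subtopology X (Some ` B)) Some"
    unfolding open_map_def
  proof (intro allI impI)
    fix U assume "openin (subtopology Z B) U"
    then obtain T where "openin Z T" "U = T \<inter> B" by (auto simp: openin_subtopology)
    then show "openin (subtopology X (Some ` B)) (Some ` U)"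
      unfolding openin_subtopology by (intro exI[of _ "Some ` T"]) (auto simp: openin_ext_image_Some)
  qed
qed (use assms in \<open>auto simp: topspace_ext\<close>)

text \<open>The complement of the closure of \<open>A\<close> is open and dense, so
  \<open>remote\<close> places a member of \<open>\<G>\<close> inside it, and this member misses
  \<open>A\<close>.\<close>

lemma None_notin_closure_of_nowhere_dense:
  assumes "A \<subseteq> topspace Z" "Z interior_of (Z closure_of A) = {}"
  shows "None \<notin> X closure_of (Some ` A)"
proof -
  let ?D = "topspace Z - Z closure_of A"
  have "Z closure_of ?D = topspace Z"
    using assms(2) by (simp add: closure_of_complement)
  then obtain g where "g \<in> \<G>" "g \<subseteq> ?D"
    using remote[of ?D] by (auto simp: openin_diff)
  moreover have "A \<subseteq> Z closure_of A" using assms(1) by (rule closure_of_subset)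
  ultimately have "g \<in> \<G>" "g \<inter> A = {}" by auto
  then show ?thesis unfolding in_closure_of_ext_None by blast
qed

text \<open>At \<open>None\<close>, adjoining \<open>None\<close> to a clopen \<open>g\<close> gives
  a clopen set. At \<open>Some z\<close>, a clopen subset of \<open>Z\<close> stays closed once some
  \<open>g\<close> misses it; such a \<open>g\<close> exists because \<open>{z}\<close> is nowhere
  dense.\<close>

lemma clopen_base_ext:
  assumes "openin X U" "x \<in> U"
  shows "\<exists>V. openin X V \<and> closedin X V \<and> x \<in> V \<and> V \<subseteq> U"
proof (cases x)
  case None
  then obtain g where g: "g \<in> \<G>" "g \<subseteq> Some -` U" using assms by (auto simp: openin_ext)
  let ?V = "insert None (Some ` g)"
  have gZ: "openin Z g" "openin Z (topspace Z - g)" "g \<subseteq> topspace Z"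
    using clopen[OF g(1)] openin_subset by auto
  have "topspace X - ?V = Some ` (topspace Z - g)" by (auto simp: topspace_ext)
  then have "openin X (topspace X - ?V)" using gZ(2) by (simp add: openin_ext_image_Some)
  moreover have "?V \<subseteq> topspace X" using gZ(3) by (auto simp: topspace_ext)
  ultimately have "closedin X ?V" by (simp add: closedin_def)
  moreover have "Some -` ?V = g" by auto
  then have "openin X ?V" using g(1) gZ(1) unfolding openin_ext by auto
  moreover have "?V \<subseteq> U" "x \<in> ?V" using g(2) None assms(2) by auto
  ultimately show ?thesis by blast
next
  case (Some z)
  have z: "openin Z (Some -` U)" "z \<in> Some -` U" using assms Some by (auto simp: openin_ext)
  then have "z \<in> topspace Z" using openin_subset by blast
  have "closedin Z {z}"
    using Hausdorff \<open>z \<in> topspace Z\<close> by (simp add: closedin_Hausdorff_singleton)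
  then have "Z interior_of (Z closure_of {z}) = {}"
    using crowded[OF \<open>z \<in> topspace Z\<close>] interior_of_subset[of Z "{z}"] openin_interior_of[of Z "{z}"]
    by (metis closure_of_closedin subset_singletonD)
  then have "None \<notin> X closure_of (Some ` {z})"
    using None_notin_closure_of_nowhere_dense \<open>z \<in> topspace Z\<close> by blast
  then obtain g where g: "g \<in> \<G>" "z \<notin> g" unfolding in_closure_of_ext_None by blast
  have "openin Z (Some -` U - g)" using z(1) g(1) clopen by (simp add: openin_diff)
  then obtain V where V: "openin Z V" "closedin Z V" "z \<in> V" "V \<subseteq> Some -` U - g"
    using clopen_base[of "Some -` U - g" z] z(2) g(2) by blast
  have "Some -` (topspace X - Some ` V) = topspace Z - V" by (auto simp: topspace_ext)
  moreover have "g \<subseteq> topspace Z - V" using V(4) clopen[OF g(1)] openin_subset by blast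
  ultimately have "openin X (topspace X - Some ` V)"
    using V(2) g(1) by (auto simp: openin_ext)
  then have "closedin X (Some ` V)"
    using openin_subset[OF V(1)] by (auto simp: closedin_def topspace_ext)
  moreover have "openin X (Some ` V)" using V(1) by (simp add: openin_ext_image_Some)
  moreover have "x \<in> Some ` V" "Some ` V \<subseteq> U" using V Some by auto
  ultimately show ?thesis by blast
qed

lemma Tychonoff_ext: "Tychonoff_space X"
proof -
  \<comment> \<open>An open set containing just one of the two points suffices: the clopen base
    shrinks it to a clopen set, and complementation puts either point inside.\<close>
  have sep: "\<exists>V. openin X V \<and> closedin X V \<and> x \<in> V \<and> y \<notin> V"
    if "x \<in> topspace X" "y \<in> topspace X" "x \<noteq> y" for x y
  proof -
    have "\<exists>U. openin X U \<and> x \<in> U \<and> y \<notin> U \<or> openin X U \<and> x \<notin> U \<and> y \<in> U"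
    proof (cases "x = None \<or> y = None")
      case True
      then have "x \<in> Some ` topspace Z \<and> y \<notin> Some ` topspace Z \<or>
          x \<notin> Some ` topspace Z \<and> y \<in> Some ` topspace Z"
        using that by (auto simp: topspace_ext)
      moreover have "openin X (Some ` topspace Z)" by (simp add: openin_ext_image_Some)
      ultimately show ?thesis by blast
    next
      case False
      then obtain a b where ab: "x = Some a" "y = Some b" by auto
      then have "a \<in> topspace Z" "b \<in> topspace Z" "a \<noteq> b" using that by (auto simp: topspace_ext)
      then obtain U V where "openin Z U" "a \<in> U" "b \<in> V" "disjnt U V"
        using Hausdorff unfolding Hausdorff_space_def by blast
      then have "openin X (Some ` U) \<and> x \<in> Some ` U \<and> y \<notin> Some ` U"
        using ab by (auto simp: openin_ext_image_Some disjnt_iff)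
      then show ?thesis by blast
    qed
    then show ?thesis
    proof (elim exE disjE conjE)
      fix U assume "openin X U" "x \<in> U" "y \<notin> U"
      then show ?thesis using clopen_base_ext[of U x] by blast
    next
      fix U assume "openin X U" "x \<notin> U" "y \<in> U"
      then obtain V where "openin X V" "closedin X V" "y \<in> V" "V \<subseteq> U"
        using clopen_base_ext[of U y] by blast
      then show ?thesis using that \<open>x \<notin> U\<close>
        by (intro exI[of _ "topspace X - V"]) auto
    qed
  qed
  have "Hausdorff_space X"
    unfolding Hausdorff_space_def
  proof (intro allI impI)
    fix x y assume xy: "x \<in> topspace X \<and> y \<in> topspace X \<and> x \<noteq> y"
    then obtain V where "openin X V" "closedin X V" "x \<in> V" "y \<notin> V" using sep by blast
    then show "\<exists>U V. openin X U \<and> openin X V \<and> x \<in> U \<and> y \<in> V \<and> disjnt U V"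
      using xy by (intro exI[of _ V] exI[of _ "topspace X - V"]) (auto simp: disjnt_iff)
  qed
  then show ?thesis
    using completely_regular_space_clopen_base clopen_base_ext
    unfolding Tychonoff_space_def by blast
qed

section \<open>Tightness properties of the extension\<close>

lemma ccc_tight_ext:
  assumes ccc: "ccc_space Z"
    and ct: "\<And>A x. \<lbrakk>A \<subseteq> topspace Z; x \<in> Z closure_of A\<rbrakk> \<Longrightarrow> \<exists>B\<subseteq>A. countable B \<and> x \<in> Z closure_of B"
  shows "ccc_tight X"
  unfolding tight_def
proof (intro allI impI)
  fix x A assume xA: "x \<in> topspace X \<and> A \<subseteq> topspace X \<and> x \<in> X closure_of A"
  have countable_case: "B \<subseteq> A \<Longrightarrow> countable B \<Longrightarrow> x \<in> X closure_of B \<Longrightarrow>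
      \<exists>B\<subseteq>A. x \<in> X closure_of B \<and> ccc_space (subtopology X B)" for B
    by (intro exI[of _ B]) (auto intro!: countable_topspace_imp_ccc_space)
  show "\<exists>B\<subseteq>A. x \<in> X closure_of B \<and> ccc_space (subtopology X B)"
  proof (cases x)
    case (Some z)
    then have "z \<in> Z closure_of (Some -` A)"
      using xA in_closure_of_ext_Some by blast
    moreover have AZ: "Some -` A \<subseteq> topspace Z" using xA by (auto simp: topspace_ext)
    ultimately obtain B where B: "B \<subseteq> Some -` A" "countable B" "z \<in> Z closure_of B"
      using ct by blast
    then have "Some ` B \<subseteq> topspace X" using AZ by (auto simp: topspace_ext)
    then have "x \<in> X closure_of (Some ` B)"
      using B(3) Some by (simp add: in_closure_of_ext_Some inj_vimage_image_eq)
    then show ?thesis using B by (intro countable_case[of "Some ` B"]) auto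
  next
    case None
    show ?thesis
    proof (cases "None \<in> A")
      case True
      then have "None \<in> X closure_of {None}" by (simp add: in_closure_of topspace_ext)
      then show ?thesis using True None by (intro countable_case[of "{None}"]) auto
    next
      case False
      \<comment> \<open>Up to a nowhere dense part, \<open>A'\<close> is dense in an open subset of a ccc space.\<close>
      define A' where "A' = Some -` A"
      have A: "A = Some ` A'" using False by (auto simp: A'_def image_iff) (metis not_Some_eq)
      have A': "A' \<subseteq> topspace Z" using xA by (auto simp: A'_def topspace_ext)
      define W where "W = Z interior_of (Z closure_of A')"
      \<comment> \<open>\<open>W\<close> is open and contained in the closure of \<open>A'\<close>,
        so every point of \<open>W\<close> is already in the closure of
        \<open>A' \<inter> W\<close>.\<close>
      define B where "B = A' \<inter> W"
      have "W \<subseteq> Z closure_of B"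
        unfolding B_def W_def
        by (metis inf.commute inf.absorb_iff2 interior_of_subset openin_Int_closure_of_subset
            openin_interior_of)
      then have "ccc_space (subtopology Z B)"
        using ccc by (intro ccc_space_dense_in_open[of Z W]) (auto simp: W_def B_def)
      then have "ccc_space (subtopology X (Some ` B))"
        using homeomorphic_map_Some[of B] A'
        by (metis B_def ccc_space_continuous_map_image homeomorphic_imp_continuous_map
            homeomorphic_imp_surjective_map inf.coboundedI1)
      moreover have "None \<in> X closure_of (Some ` B)"
      proof -
        have "Z interior_of (Z closure_of (A' - W)) = {}"
          unfolding W_def by (rule nowhere_dense_Diff)
        then have "None \<notin> X closure_of (Some ` (A' - W))"
          using A' by (intro None_notin_closure_of_nowhere_dense) auto
        \<comment> \<open>Closure distributes over this union, so \<open>None\<close> can only come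
          from the part \<open>B\<close>.\<close>
        moreover have "Some ` A' = Some ` B \<union> Some ` (A' - W)" by (auto simp: B_def)
        ultimately show ?thesis
          using xA None by (simp add: A closure_of_Un)
      qed
      ultimately show ?thesis
        using A None by (intro exI[of _ "Some ` B"]) (auto simp: B_def)
    qed
  qed
qed

text \<open>Members of \<open>\<G>\<close> are nonempty, so \<open>None\<close> is in the closure of
  all of \<open>Z\<close>. A Lindelof witness for this would be nowhere dense, against
  remoteness.\<close>

lemma not_Lindelof_tight_ext:
  assumes "\<And>L. \<lbrakk>L \<subseteq> topspace Z; Lindelof_space (subtopology Z L)\<rbrakk> \<Longrightarrow> Z interior_of (Z closure_of L) = {}"
  shows "\<not> Lindelof_tight X"
proof
  assume lt: "Lindelof_tight X"
  have "None \<in> X closure_of (Some ` topspace Z)"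
    unfolding in_closure_of_ext_None
    using clopen openin_subset by (metis inf.absorb_iff1)
  moreover have "Some ` topspace Z \<subseteq> topspace X" "None \<in> topspace X" by (auto simp: topspace_ext)
  ultimately obtain B where B: "B \<subseteq> Some ` topspace Z" "None \<in> X closure_of B"
      "Lindelof_space (subtopology X B)"
    using lt unfolding tight_def by blast
  then obtain L where L: "L \<subseteq> topspace Z" "B = Some ` L" by (metis subset_imageE)
  have "Lindelof_space (subtopology Z L)"
    using homeomorphic_map_Some[OF L(1)] B(3) L(2)
    by (metis homeomorphic_map_imp_homeomorphic_space homeomorphic_map_maps
        homeomorphic_maps_map homeomorphic_imp_continuous_map homeomorphic_imp_surjective_map
        Lindelof_space_continuous_map_image)
  then have "None \<notin> X closure_of B"
    using assms None_notin_closure_of_nowhere_dense L by blast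
  then show False using B(2) by blast
qed

end

section \<open>Countably many copies of a space\<close>

text \<open>The topological sum of countably many copies, taken as a product with a discrete factor;
  its open sets, closed sets and closures are computed slice by slice.\<close>

abbreviation (input) nat_copies :: "'a topology \<Rightarrow> (nat \<times> 'a) topology" where
  "nat_copies Y \<equiv> prod_topology (discrete_topology UNIV) Y"

lemma openin_nat_copies: "openin (nat_copies Y) U \<longleftrightarrow> (\<forall>n. openin Y (Pair n -` U))"
proof
  assume U: "openin (nat_copies Y) U"
  show "\<forall>n. openin Y (Pair n -` U)"
  proof
    fix n
    have "continuous_map Y (nat_copies Y) (Pair n)"
      by (intro continuous_map_pairedI) auto
    then have "openin Y {y \<in> topspace Y. (n, y) \<in> U}"
      using U by (rule openin_continuous_map_preimage)
    moreover have "{y \<in> topspace Y. (n, y) \<in> U} = Pair n -` U"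
      using openin_subset[OF U] by auto
    ultimately show "openin Y (Pair n -` U)" by simp
  qed
next
  assume U: "\<forall>n. openin Y (Pair n -` U)"
  have "openin (nat_copies Y) (\<Union>n. {n} \<times> (Pair n -` U))"
    using U by (intro openin_Union) (auto simp: openin_prod_Times_iff)
  moreover have "(\<Union>n. {n} \<times> (Pair n -` U)) = U" by auto
  ultimately show "openin (nat_copies Y) U" by simp
qed

lemma closedin_nat_copies: "closedin (nat_copies Y) U \<longleftrightarrow> (\<forall>n. closedin Y (Pair n -` U))"
proof -
  have "Pair n -` (topspace (nat_copies Y) - U) = topspace Y - Pair n -` U" for n by auto
  then show ?thesis
    by (force simp: closedin_def openin_nat_copies)
qed

lemma in_closure_of_nat_copies:
  "(n, y) \<in> nat_copies Y closure_of A \<longleftrightarrow> y \<in> Y closure_of (Pair n -` A)"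
proof
  assume A: "(n, y) \<in> nat_copies Y closure_of A"
  have "\<exists>x. x \<in> Pair n -` A \<and> x \<in> T" if "y \<in> T" "openin Y T" for T
  proof -
    have "openin (nat_copies Y) ({n} \<times> T)" "(n, y) \<in> {n} \<times> T"
      using that by (simp_all add: openin_prod_Times_iff)
    then obtain z where "z \<in> A" "z \<in> {n} \<times> T"
      using A unfolding in_closure_of by meson
    then show ?thesis by auto
  qed
  then show "y \<in> Y closure_of (Pair n -` A)" using A by (simp add: in_closure_of)
next
  assume A: "y \<in> Y closure_of (Pair n -` A)"
  have "\<exists>z. z \<in> A \<and> z \<in> T" if "(n, y) \<in> T" "openin (nat_copies Y) T" for T
  proof -
    have "openin Y (Pair n -` T)" "y \<in> Pair n -` T" using that by (simp_all add: openin_nat_copies)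
    then obtain x where "x \<in> Pair n -` A" "x \<in> Pair n -` T"
      using A unfolding in_closure_of by blast
    then show ?thesis by auto
  qed
  then show "(n, y) \<in> nat_copies Y closure_of A" using A by (simp add: in_closure_of)
qed

text \<open>Every member of a disjoint family has a nonempty slice, and each of the countably many
  copies admits only countably many members with a nonempty slice there.\<close>

lemma ccc_nat_copies:
  assumes "ccc_space Y"
  shows "ccc_space (nat_copies Y)"
  unfolding ccc_space_def
proof (intro allI impI)
  fix \<U> assume U: "(\<forall>U\<in>\<U>. openin (nat_copies Y) U \<and> U \<noteq> {}) \<and> pairwise disjnt \<U>"
  have "countable {U \<in> \<U>. Pair n -` U \<noteq> {}}" for n
  proof (rule ccc_space_disjoint_family[OF assms])
    fix V assume "V \<in> {U \<in> \<U>. Pair n -` U \<noteq> {}}"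
    then show "openin Y (Pair n -` V) \<and> Pair n -` V \<noteq> {}"
      using U by (simp add: openin_nat_copies)
  next
    fix V W assume "V \<in> {U \<in> \<U>. Pair n -` U \<noteq> {}}" "W \<in> {U \<in> \<U>. Pair n -` U \<noteq> {}}" "V \<noteq> W"
    then have "disjnt V W" using U by (simp add: pairwise_def)
    then show "disjnt (Pair n -` V) (Pair n -` W)" by (auto simp: disjnt_iff)
  qed
  then have "countable (\<Union>n. {U \<in> \<U>. Pair n -` U \<noteq> {}})" by simp
  moreover have "\<U> \<subseteq> (\<Union>n. {U \<in> \<U>. Pair n -` U \<noteq> {}})"
  proof
    fix V assume V: "V \<in> \<U>"
    then have "V \<noteq> {}" using U by simp
    then obtain n y where "(n, y) \<in> V" by auto
    then show "V \<in> (\<Union>n. {U \<in> \<U>. Pair n -` U \<noteq> {}})" using V by auto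
  qed
  ultimately show "countable \<U>" by (rule countable_subset[rotated])
qed

text \<open>The part of \<open>L\<close> in copy \<open>n\<close> is relatively closed, hence
  Lindelof, and the projection maps it continuously onto the slice.\<close>

lemma Lindelof_space_nat_copies_slice:
  assumes L: "L \<subseteq> topspace (nat_copies Y)" "Lindelof_space (subtopology (nat_copies Y) L)"
  shows "Lindelof_space (subtopology Y (Pair n -` L))"
proof -
  let ?Z = "nat_copies Y" and ?L = "{n} \<times> (Pair n -` L)"
  have sub: "?L \<subseteq> L" by auto
  have "closedin ?Z ({n} \<times> topspace Y)" by (simp add: closedin_prod_Times_iff)
  moreover have "?L = {n} \<times> topspace Y \<inter> L" using L(1) by auto
  ultimately have "closedin (subtopology ?Z L) ?L"
    unfolding closedin_subtopology by blast
  then have "Lindelof_space (subtopology (subtopology ?Z L) ?L)"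
    using L(2) by (rule Lindelof_space_closedin_subtopology[rotated])
  then have "Lindelof_space (subtopology ?Z ?L)"
    using sub by (simp add: subtopology_subtopology inf.absorb2)
  then show ?thesis
  proof (rule Lindelof_space_continuous_map_image)
    show "continuous_map (subtopology ?Z ?L) (subtopology Y (Pair n -` L)) snd"
      by (auto simp: continuous_map_in_subtopology
          intro: continuous_map_from_subtopology continuous_map_snd)
    show "snd ` topspace (subtopology ?Z ?L) = topspace (subtopology Y (Pair n -` L))"
      by force
  qed
qed

lemma nat_copies_nowhere_dense:
  assumes "\<And>n. Y interior_of (Y closure_of (Pair n -` A)) = {}"
  shows "nat_copies Y interior_of (nat_copies Y closure_of A) = {}"
proof (rule ccontr)
  let ?U = "nat_copies Y interior_of (nat_copies Y closure_of A)"
  assume "?U \<noteq> {}"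
  then obtain n y where "(n, y) \<in> ?U" by auto
  moreover have "openin Y (Pair n -` ?U)"
    using openin_interior_of[of "nat_copies Y"] unfolding openin_nat_copies by blast
  moreover have "Pair n -` ?U \<subseteq> Y closure_of (Pair n -` A)"
    using interior_of_subset[of "nat_copies Y" "nat_copies Y closure_of A"]
    by (auto simp: in_closure_of_nat_copies[symmetric])
  ultimately have "y \<in> Y interior_of (Y closure_of (Pair n -` A))"
    by (auto simp: interior_of_def)
  then show False using assms by blast
qed

section \<open>The Pixley-Roy space of the Cantor set\<close>

text \<open>The word names the cylinder of level \<open>k\<close> containing \<open>x\<close>; two
  sets with equal images under \<open>initial_bits k\<close> meet the same cylinders.\<close>

definition initial_bits :: "nat \<Rightarrow> (nat \<Rightarrow> bool) \<Rightarrow> bool list" where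
  "initial_bits k x = map x [0..<k]"

text \<open>
  The basic Pixley-Roy neighbourhood \<open>{G. F \<subseteq> G \<subseteq> U}\<close> of \<open>F\<close>, where \<open>U\<close> is the union of the
  cylinders of level \<open>k\<close> that meet \<open>F\<close>.
\<close>
definition pr_ball :: "nat \<Rightarrow> (nat \<Rightarrow> bool) set \<Rightarrow> (nat \<Rightarrow> bool) set set" where
  "pr_ball k F = {G. finite G \<and> F \<subseteq> G \<and> initial_bits k ` G = initial_bits k ` F}"

text \<open>Requiring members to be finite and nonempty is what cuts the carrier down from all sets
  of sequences.\<close>

definition pixley_roy :: "(nat \<Rightarrow> bool) set topology" where
  "pixley_roy = topology (\<lambda>\<U>. \<forall>F\<in>\<U>. finite F \<and> F \<noteq> {} \<and> (\<exists>k. pr_ball k F \<subseteq> \<U>))"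

lemma initial_bits_eq_iff: "initial_bits k x = initial_bits k y \<longleftrightarrow> (\<forall>i<k. x i = y i)"
  by (auto simp: initial_bits_def)

lemma image_initial_bits_le:
  assumes "initial_bits k ` F = initial_bits k ` G" "j \<le> k"
  shows "initial_bits j ` F = initial_bits j ` G"
proof -
  have "initial_bits j = take j \<circ> initial_bits k"
    using assms(2) by (auto simp: initial_bits_def fun_eq_iff take_map)
  then show ?thesis
    by (metis assms(1) image_comp)
qed

text \<open>Finitely many sequences are told apart by finitely many bits: the new level exceeds the
  old one and one index of difference for each old point.\<close>

lemma ex_inj_on_initial_bits:
  assumes "finite F"
  shows "\<exists>k. inj_on (initial_bits k) F"
  using assms
proof induction
  case (insert x F)
  then obtain k where k: "inj_on (initial_bits k) F" by blast
  have "\<forall>y\<in>F. \<exists>i. x i \<noteq> y i"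
    proof
    fix y assume "y \<in> F"
    then have "x \<noteq> y" using insert.hyps(2) by blast
    then show "\<exists>i. x i \<noteq> y i" by (simp add: fun_eq_iff)
  qed
  then obtain d where d: "\<And>y. y \<in> F \<Longrightarrow> x (d y) \<noteq> y (d y)" by metis
  \<comment> \<open>The successor is needed because level \<open>m\<close> reads only the bits below
    \<open>m\<close>.\<close>
  define m where "m = Max (insert k (Suc ` d ` F))"
  have "k \<le> m" and m: "\<And>y. y \<in> F \<Longrightarrow> d y < m"
    using insert.hyps(1) by (auto simp: m_def Suc_le_eq[symmetric])
  have "inj_on (initial_bits m) F"
    using k \<open>k \<le> m\<close> by (force simp: inj_on_def initial_bits_eq_iff)
  moreover have "initial_bits m x \<notin> initial_bits m ` F"
  proof
    assume "initial_bits m x \<in> initial_bits m ` F"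
    then obtain y where "y \<in> F" "initial_bits m x = initial_bits m y" by blast
    then show False using d m unfolding initial_bits_eq_iff by blast
  qed
  ultimately have "inj_on (initial_bits m) (insert x F)"
    by (auto simp: inj_on_insert)
  then show ?case by blast
qed auto

lemma mem_pr_ball_self: "finite F \<Longrightarrow> F \<in> pr_ball k F"
  by (auto simp: pr_ball_def)

lemma pr_ball_antimono: "j \<le> k \<Longrightarrow> pr_ball k F \<subseteq> pr_ball j F"
  unfolding pr_ball_def using image_initial_bits_le by blast

text \<open>A member of a ball meets the same cylinders as the centre, so the level need not grow
  when the centre moves. This makes balls open.\<close>

lemma pr_ball_subset: "G \<in> pr_ball k F \<Longrightarrow> pr_ball k G \<subseteq> pr_ball k F"
  by (auto simp: pr_ball_def)

lemma openin_pixley_roy: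
  "openin pixley_roy \<U> \<longleftrightarrow> (\<forall>F\<in>\<U>. finite F \<and> F \<noteq> {} \<and> (\<exists>k. pr_ball k F \<subseteq> \<U>))"
proof -
  have "istopology (\<lambda>\<U>. \<forall>F\<in>\<U>. finite F \<and> F \<noteq> {} \<and> (\<exists>k. pr_ball k F \<subseteq> \<U>))"
    unfolding istopology_def
  proof (intro conjI allI impI ballI)
    fix \<U> \<V> F
    assume U: "\<forall>F\<in>\<U>. finite F \<and> F \<noteq> {} \<and> (\<exists>k. pr_ball k F \<subseteq> \<U>)"
      and V: "\<forall>F\<in>\<V>. finite F \<and> F \<noteq> {} \<and> (\<exists>k. pr_ball k F \<subseteq> \<V>)" and F: "F \<in> \<U> \<inter> \<V>"
    obtain i where i: "pr_ball i F \<subseteq> \<U>" using U F by blast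
    obtain j where j: "pr_ball j F \<subseteq> \<V>" using V F by blast
    have "pr_ball (max i j) F \<subseteq> \<U> \<inter> \<V>"
      using pr_ball_antimono[of i "max i j" F] pr_ball_antimono[of j "max i j" F] i j by auto
    then show "\<exists>k. pr_ball k F \<subseteq> \<U> \<inter> \<V>" by (rule exI)
    show "finite F" "F \<noteq> {}" using U F by simp_all
  next
    fix \<K> F
    assume *: "\<forall>K\<in>\<K>. \<forall>F\<in>K. finite F \<and> F \<noteq> {} \<and> (\<exists>k. pr_ball k F \<subseteq> K)" and "F \<in> \<Union>\<K>"
    then obtain K where K: "K \<in> \<K>" "F \<in> K" by blast
    then obtain k where "pr_ball k F \<subseteq> K" using * by meson
    then have "pr_ball k F \<subseteq> \<Union>\<K>" using K(1) by blast
    then show "\<exists>k. pr_ball k F \<subseteq> \<Union>\<K>" by (rule exI)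
    show "finite F" "F \<noteq> {}" using K * by simp_all
  qed
  then show ?thesis
    by (simp add: pixley_roy_def topology_inverse')
qed

lemma openin_pixley_royE:
  assumes "openin pixley_roy \<U>" "F \<in> \<U>"
  obtains k where "finite F" "F \<noteq> {}" "pr_ball k F \<subseteq> \<U>"
  using assms unfolding openin_pixley_roy by meson

lemma openin_pr_ball:
  assumes "F \<noteq> {}"
  shows "openin pixley_roy (pr_ball k F)"
  unfolding openin_pixley_roy
proof (intro ballI conjI)
  fix G assume G: "G \<in> pr_ball k F"
  then show "finite G" "G \<noteq> {}" using assms by (auto simp: pr_ball_def)
  show "\<exists>k'. pr_ball k' G \<subseteq> pr_ball k F" using pr_ball_subset[OF G] by blast
qed

lemma topspace_pixley_roy: "topspace pixley_roy = {F. finite F \<and> F \<noteq> {}}"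
proof
  show "topspace pixley_roy \<subseteq> {F. finite F \<and> F \<noteq> {}}"
    using openin_topspace[of pixley_roy] unfolding openin_pixley_roy by blast
  have "openin pixley_roy {F. finite F \<and> F \<noteq> {}}"
    unfolding openin_pixley_roy by (auto simp: pr_ball_def)
  then show "{F. finite F \<and> F \<noteq> {}} \<subseteq> topspace pixley_roy"
    by (rule openin_subset)
qed

text \<open>If \<open>F \<subseteq> H\<close>, then \<open>H\<close> meets other cylinders of level
  \<open>k\<close> than \<open>F\<close>, and so does everything in \<open>pr_ball k H\<close>.
  Otherwise some \<open>f \<in> F\<close> is separated from \<open>H\<close> at a level
  \<open>j\<close>, and no member of \<open>pr_ball j H\<close> can contain
  \<open>f\<close>.\<close>

lemma pr_ball_disjoint_pr_ball:
  assumes "finite F" "finite H" "H \<notin> pr_ball k F"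
  shows "\<exists>j. pr_ball j H \<inter> pr_ball k F = {}"
proof (cases "F \<subseteq> H")
  case True
  then have "initial_bits k ` H \<noteq> initial_bits k ` F"
    using assms by (auto simp: pr_ball_def)
  then have "pr_ball k H \<inter> pr_ball k F = {}" by (auto simp: pr_ball_def)
  then show ?thesis by blast
next
  case False
  then obtain f where f: "f \<in> F" "f \<notin> H" by blast
  obtain j where j: "inj_on (initial_bits j) (insert f H)"
    using ex_inj_on_initial_bits assms by blast
  have "pr_ball j H \<inter> pr_ball k F = {}"
  proof (rule ccontr)
    assume "pr_ball j H \<inter> pr_ball k F \<noteq> {}"
    then obtain G where "F \<subseteq> G" "initial_bits j ` G = initial_bits j ` H"
      by (auto simp: pr_ball_def)
    then have "initial_bits j f \<in> initial_bits j ` H" using f by blast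
    then show False using j f by (auto simp: inj_on_def)
  qed
  then show ?thesis by blast
qed

lemma closedin_pr_ball:
  assumes "finite F" "F \<noteq> {}"
  shows "closedin pixley_roy (pr_ball k F)"
  unfolding closedin_def
proof
  show "pr_ball k F \<subseteq> topspace pixley_roy"
    using openin_pr_ball[OF assms(2)] by (rule openin_subset)
  show "openin pixley_roy (topspace pixley_roy - pr_ball k F)"
    unfolding openin_pixley_roy
  proof (intro ballI conjI)
    fix H assume H: "H \<in> topspace pixley_roy - pr_ball k F"
    then show "finite H" "H \<noteq> {}" by (auto simp: topspace_pixley_roy)
    then obtain j where "pr_ball j H \<inter> pr_ball k F = {}"
      using pr_ball_disjoint_pr_ball[OF assms(1), of H] H by blast
    moreover have "pr_ball j H \<subseteq> topspace pixley_roy"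
      using openin_pr_ball[OF \<open>H \<noteq> {}\<close>] by (rule openin_subset)
    ultimately show "\<exists>j. pr_ball j H \<subseteq> topspace pixley_roy - pr_ball k F" by blast
  qed
qed

section \<open>Lindelof subspaces, chain condition, separation and countable tightness\<close>

lemma Lindelof_pixley_roy_countable:
  assumes "L \<subseteq> topspace pixley_roy" and "Lindelof_space (subtopology pixley_roy L)"
  shows "countable L"
proof -
  \<comment> \<open>If level \<open>k\<close> separates the points of \<open>G\<close>, then \<open>G\<close> itself is the only \<open>H\<close> with \<open>G \<in> pr_ball k H\<close>.\<close>
  have "countable {G \<in> L. inj_on (initial_bits k) G}" for k
  proof -
    have "L \<subseteq> \<Union>(pr_ball k ` L)"
      using assms(1) mem_pr_ball_self by (auto simp: topspace_pixley_roy)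
    moreover have "\<forall>U\<in>pr_ball k ` L. openin pixley_roy U"
      using assms(1) by (auto simp: topspace_pixley_roy intro!: openin_pr_ball)
    ultimately obtain \<V> where "countable \<V>" "\<V> \<subseteq> pr_ball k ` L" "L \<subseteq> \<Union>\<V>"
      using assms unfolding Lindelof_space_subtopology_subset[OF assms(1)] by meson
    then obtain J where J: "countable J" "J \<subseteq> L" "L \<subseteq> \<Union>(pr_ball k ` J)"
      using countable_subset_image[of \<V> "pr_ball k" L] by auto
    have "{G \<in> L. inj_on (initial_bits k) G} \<subseteq> J"
    proof clarify
      fix G assume G: "G \<in> L" "inj_on (initial_bits k) G"
      then obtain H where H: "H \<in> J" "G \<in> pr_ball k H" using J by blast
      then have "H = G" using G by (auto simp: pr_ball_def inj_on_image_eq_iff)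
      then show "G \<in> J" using H by simp
    qed
    then show ?thesis using J(1) countable_subset by blast
  qed
  moreover have "L \<subseteq> (\<Union>k. {G \<in> L. inj_on (initial_bits k) G})"
    using assms(1) ex_inj_on_initial_bits by (auto simp: topspace_pixley_roy)
  ultimately show ?thesis
    by (meson countable_UN countable_subset countableI_type)
qed

text \<open>Some \<open>x\<close> in a cylinder met by \<open>F\<close> lies in no member of
  \<open>L\<close>. Adding it to the centre stays in the ball, and all sets in the ball around
  \<open>insert x F\<close> contain \<open>x\<close>.\<close>

lemma countable_pixley_roy_nowhere_dense:
  assumes "countable L" "L \<subseteq> topspace pixley_roy" "openin pixley_roy \<U>" "\<U> \<noteq> {}"
  obtains \<V> where "openin pixley_roy \<V>" "\<V> \<noteq> {}" "\<V> \<subseteq> \<U>" "\<V> \<inter> L = {}"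
proof -
  obtain F where "F \<in> \<U>" using assms(4) by blast
  then obtain k where F: "finite F" "F \<noteq> {}" "pr_ball k F \<subseteq> \<U>"
    using assms(3) unfolding openin_pixley_roy by blast
  obtain f where f: "f \<in> F" using F(2) by blast
  have "countable (\<Union>G\<in>L. G)"
    using assms(1,2) by (intro countable_UN) (auto simp: topspace_pixley_roy intro: countable_finite)
  \<comment> \<open>Inserting \<open>f\<close> makes the set nonempty, so that a sequence enumerates
    it.\<close>
  then have "countable (insert f (\<Union>L))" by simp
  then obtain a :: "nat \<Rightarrow> nat \<Rightarrow> bool" where a: "insert f (\<Union>L) = range a"
    by (metis insert_not_empty range_from_nat_into)
  \<comment> \<open>A shifted diagonal: \<open>x\<close> copies \<open>k\<close> bits of
    \<open>f\<close> to stay in its cylinder, then differs from \<open>a n\<close> at index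
    \<open>n + k\<close>.\<close>
  define x where "x i = (if i < k then f i else \<not> a (i - k) i)" for i
  have "x \<noteq> a n" for n
  proof
    assume "x = a n"
    then have "x (n + k) = a n (n + k)" by simp
    then show False by (simp add: x_def)
  qed
  then have x: "x \<notin> \<Union>L" using a by blast
  have "initial_bits k x = initial_bits k f"
    by (simp add: initial_bits_eq_iff x_def)
  then have G: "insert x F \<in> pr_ball k F"
    using F(1) f by (auto simp: pr_ball_def)
  have "pr_ball k (insert x F) \<inter> L = {}" using x by (auto simp: pr_ball_def)
  then show ?thesis
    using that[of "pr_ball k (insert x F)"] openin_pr_ball[of "insert x F"] F pr_ball_subset[OF G]
      mem_pr_ball_self[of "insert x F" k] by blast
qed

lemma ccc_pixley_roy: "ccc_space pixley_roy"
  unfolding ccc_space_def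
proof (intro allI impI)
  fix \<C> :: "(nat \<Rightarrow> bool) set set set"
  assume C: "(\<forall>U\<in>\<C>. openin pixley_roy U \<and> U \<noteq> {}) \<and> pairwise disjnt \<C>"
  have "\<exists>F k. finite F \<and> F \<noteq> {} \<and> pr_ball k F \<subseteq> U" if "U \<in> \<C>" for U
  proof -
    have U: "openin pixley_roy U" "U \<noteq> {}" using C that by simp_all
    then obtain F where "F \<in> U" by blast
    then show ?thesis using U(1) by (metis openin_pixley_royE)
  qed
  then obtain F k where Fk: "\<And>U. U \<in> \<C> \<Longrightarrow> finite (F U) \<and> F U \<noteq> {} \<and> pr_ball (k U) (F U) \<subseteq> U"
    by metis
  define c where "c U = (k U, initial_bits (k U) ` F U)" for U
  \<comment> \<open>Two balls with the same code both contain the union of their centres.\<close>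
  have "inj_on c \<C>"
  proof (rule inj_onI)
    fix U V assume UV: "U \<in> \<C>" "V \<in> \<C>" "c U = c V"
    then have "F U \<union> F V \<in> pr_ball (k U) (F U)" "F U \<union> F V \<in> pr_ball (k V) (F V)"
      using Fk[OF UV(1)] Fk[OF UV(2)] by (auto simp: c_def pr_ball_def image_Un)
    then have "\<not> disjnt U V" using Fk UV by (meson disjnt_iff subsetD)
    then show "U = V" using C UV by (auto simp: pairwise_def)
  qed
  moreover have "c ` \<C> \<subseteq> UNIV \<times> Collect finite"
    using Fk by (auto simp: c_def)
  moreover have "countable (UNIV \<times> Collect finite :: (nat \<times> bool list set) set)"
    by (intro countable_SIGMA countable_Collect_finite) auto
  ultimately show "countable \<C>"
    by (metis countable_image_inj_on countable_subset)
qed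

lemma Hausdorff_pixley_roy: "Hausdorff_space pixley_roy"
proof -
  have sep: "\<exists>U V. openin pixley_roy U \<and> openin pixley_roy V \<and> F \<in> U \<and> H \<in> V \<and> disjnt U V"
    if FH: "finite F" "F \<noteq> {}" "finite H" "H \<noteq> {}" "\<not> F \<subseteq> H" for F H
  proof -
    \<comment> \<open>There is only one cylinder of level 0, so this ball consists of all finite
      supersets of the nonempty \<open>F\<close>.\<close>
    have "H \<notin> pr_ball 0 F" using FH(5) by (simp add: pr_ball_def)
    then obtain j where "pr_ball j H \<inter> pr_ball 0 F = {}"
      using pr_ball_disjoint_pr_ball[OF FH(1,3)] by blast
    then have "disjnt (pr_ball 0 F) (pr_ball j H)" by (simp add: disjnt_def Int_commute)
    then show ?thesis
      using FH by (intro exI conjI) (simp_all add: openin_pr_ball mem_pr_ball_self)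
  qed
  show ?thesis
    unfolding Hausdorff_space_def topspace_pixley_roy
  proof (intro allI impI)
    fix F H :: "(nat \<Rightarrow> bool) set"
    assume *: "F \<in> {F. finite F \<and> F \<noteq> {}} \<and> H \<in> {F. finite F \<and> F \<noteq> {}} \<and> F \<noteq> H"
    then consider "\<not> F \<subseteq> H" | "\<not> H \<subseteq> F" by blast
    then show "\<exists>U V. openin pixley_roy U \<and> openin pixley_roy V \<and> F \<in> U \<and> H \<in> V \<and> disjnt U V"
    proof cases
      case 1
      then show ?thesis using * by (intro sep) auto
    next
      case 2
      then have "\<exists>V U. openin pixley_roy V \<and> openin pixley_roy U \<and> H \<in> V \<and> F \<in> U \<and> disjnt V U"
        using * by (intro sep) auto
      then show ?thesis by (meson disjnt_sym)
    qed
  qed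
qed

text \<open>The balls around \<open>F\<close> form a countable neighbourhood base; one point of
  \<open>A\<close> from each suffices.\<close>

lemma countable_tight_pixley_roy:
  assumes "F \<in> pixley_roy closure_of A"
  shows "\<exists>B\<subseteq>A. countable B \<and> F \<in> pixley_roy closure_of B"
proof -
  have F: "finite F" "F \<noteq> {}" using assms by (auto simp: in_closure_of topspace_pixley_roy)
  have "\<exists>G. G \<in> A \<and> G \<in> pr_ball k F" for k
    using assms openin_pr_ball[OF F(2)] mem_pr_ball_self[OF F(1)] unfolding in_closure_of by blast
  then obtain a where a: "\<And>k. a k \<in> A" "\<And>k. a k \<in> pr_ball k F" by metis
  have "\<exists>G. G \<in> range a \<and> G \<in> T" if "F \<in> T" "openin pixley_roy T" for T
    using that a(2) by (metis openin_pixley_royE rangeI subsetD)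
  then have "F \<in> pixley_roy closure_of range a"
    using F by (simp add: in_closure_of topspace_pixley_roy)
  then show ?thesis using a(1) by (intro exI[of _ "range a"]) auto
qed

lemma countable_pixley_roy_interior_of_closure_of:
  assumes "countable L" "L \<subseteq> topspace pixley_roy"
  shows "pixley_roy interior_of (pixley_roy closure_of L) = {}"
proof (rule ccontr)
  let ?U = "pixley_roy interior_of (pixley_roy closure_of L)"
  assume "?U \<noteq> {}"
  then obtain \<V> where V: "openin pixley_roy \<V>" "\<V> \<noteq> {}" "\<V> \<subseteq> ?U" "\<V> \<inter> L = {}"
    using countable_pixley_roy_nowhere_dense[OF assms openin_interior_of] by blast
  then have "\<V> \<inter> pixley_roy closure_of L = {}"
    by (simp add: openin_Int_closure_of_eq_empty)
  then show False
    using V interior_of_subset[of pixley_roy "pixley_roy closure_of L"] by blast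
qed

section \<open>Linked families of clopen sets\<close>

text \<open>Van Douwen's construction of remote points, with the index of a base element as its rank.\<close>
lemma n_linked_clopen_subsets:
  fixes Y :: "'a topology" and \<B> :: "nat \<Rightarrow> 'a set set" and dense_open :: "'a set \<Rightarrow> bool"
  assumes mono: "\<And>i j. i \<le> j \<Longrightarrow> \<B> i \<subseteq> \<B> j" and B0: "B0 \<in> \<B> m0"
    and step: "\<And>D m. dense_open D \<Longrightarrow> \<exists>M\<ge>m. \<exists>C. openin Y C \<and> closedin Y C \<and> C \<subseteq> D \<and>
           (\<forall>B\<in>\<B> m. \<exists>B'\<in>\<B> M. B' \<subseteq> B \<inter> C)"
  shows "\<exists>G. (\<forall>D. dense_open D \<longrightarrow> openin Y (G D) \<and> closedin Y (G D) \<and> G D \<subseteq> D) \<and>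
           (\<forall>S. finite S \<and> card S \<le> n \<and> Ball S dense_open \<longrightarrow> (\<exists>i. \<exists>B\<in>\<B> i. B \<subseteq> \<Inter>(G ` S)))"
proof -
  obtain M C where MC: "\<And>D m. dense_open D \<Longrightarrow> m \<le> M D m \<and> openin Y (C D m) \<and>
      closedin Y (C D m) \<and> C D m \<subseteq> D \<and> (\<forall>B\<in>\<B> m. \<exists>B'\<in>\<B> (M D m). B' \<subseteq> B \<inter> C D m)"
    using step by metis
  \<comment> \<open>Successive rank bounds for \<open>D\<close>: inside any base element of index
    \<open>r D j\<close>, the set \<open>C D (r D j)\<close> contains one of index
    \<open>r D (Suc j)\<close>.\<close>
  define r where "r D j = (M D ^^ j) m0" for D j
  have r: "r D 0 = m0" "r D (Suc j) = M D (r D j)" for D j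
    by (auto simp: r_def)
  \<comment> \<open>A union over \<open>n\<close> stages, because the stage at which
    \<open>D\<close> is treated depends on the other members of \<open>S\<close>.\<close>
  define G where "G D = (\<Union>j<n. C D (r D j))" for D
  \<comment> \<open>Generalised for induction: \<open>t\<close> sets remain to be treated, from
    stage \<open>j\<close> on, inside a base element whose index is below all their current
    bounds.\<close>
  have linked: "\<exists>i. \<exists>B'\<in>\<B> i. B' \<subseteq> B \<and> (\<forall>D\<in>S. \<exists>l<j + t. B' \<subseteq> C D (r D l))"
    if "finite S" "card S = t" "Ball S dense_open" "B \<in> \<B> b" "\<forall>D\<in>S. b \<le> r D j" for S t j B b
    using that
  proof (induction t arbitrary: S j B b)
    case 0
    then show ?case by auto
  next
    case (Suc t)
    then have "S \<noteq> {}" by auto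
    \<comment> \<open>The slowest-growing bound goes first: the next ball then lies within the bounds of all others.\<close>
    define D where "D = arg_min_on (\<lambda>D. r D (Suc j)) S"
    have D: "D \<in> S" "\<And>E. E \<in> S \<Longrightarrow> r D (Suc j) \<le> r E (Suc j)"
      using Suc.prems(1) \<open>S \<noteq> {}\<close>
      by (auto simp: D_def arg_min_if_finite(1) intro: arg_min_least)
    have "B \<in> \<B> (r D j)" using mono Suc.prems D(1) by blast
    then obtain B1 where B1: "B1 \<in> \<B> (r D (Suc j))" "B1 \<subseteq> B \<inter> C D (r D j)"
      using MC Suc.prems(3) D(1) unfolding r by meson
    have "\<exists>i. \<exists>B'\<in>\<B> i. B' \<subseteq> B1 \<and> (\<forall>E\<in>S - {D}. \<exists>l<Suc j + t. B' \<subseteq> C E (r E l))"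
      using Suc.prems D B1(1) by (intro Suc.IH) auto
    then obtain i B' where B': "B' \<in> \<B> i" "B' \<subseteq> B1"
      "\<forall>E\<in>S - {D}. \<exists>l<Suc j + t. B' \<subseteq> C E (r E l)" by blast
    have "\<exists>l<j + Suc t. B' \<subseteq> C E (r E l)" if "E \<in> S" for E
    proof (cases "E = D")
      case True
      then show ?thesis using B1(2) B'(2) by (intro exI[of _ j]) auto
    next
      case False
      then show ?thesis using B'(3) that by simp
    qed
    moreover have "B' \<subseteq> B" using B'(2) B1(2) by blast
    ultimately show ?case using B'(1) by (intro exI[of _ i] bexI[of _ B']) simp_all
  qed
  have "\<exists>i. \<exists>B\<in>\<B> i. B \<subseteq> \<Inter>(G ` S)"
    if S: "finite S" "card S \<le> n" "Ball S dense_open" for S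
  proof -
    \<comment> \<open>At stage 0 all bounds equal \<open>m0\<close>, the index of
      \<open>B0\<close>.\<close>
    obtain i B where B: "B \<in> \<B> i" "\<forall>D\<in>S. \<exists>l<0 + card S. B \<subseteq> C D (r D l)"
      using linked[OF S(1) refl S(3) B0, of 0] by (auto simp: r)
    have "B \<subseteq> G D" if D: "D \<in> S" for D
    proof -
      obtain l where "l < card S" "B \<subseteq> C D (r D l)" using B(2) D by auto
      then show ?thesis using S(2) unfolding G_def by fastforce
    qed
    then show ?thesis using B(1) by blast
  qed
  moreover have "openin Y (G D) \<and> closedin Y (G D) \<and> G D \<subseteq> D" if "dense_open D" for D
    using MC[OF that] unfolding G_def by (auto intro!: closedin_Union)
  ultimately show ?thesis by blast
qed

section \<open>Compactness of the space of tuples, and refinement of balls\<close>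

lemma compact_space_fun:
  assumes "compact_space (euclidean :: 'b::topological_space topology)"
  shows "compact_space (euclidean :: ('a \<Rightarrow> 'b) topology)"
  unfolding euclidean_product_topology[symmetric] compact_space_product_topology
  using assms by blast

text \<open>Tuples of points of the Cantor set are stored as infinite sequences, so Tychonoff's
  theorem is applied twice.\<close>

lemma compact_UNIV_bool_sequences: "compact (UNIV :: (nat \<Rightarrow> nat \<Rightarrow> bool) set)"
proof -
  have "compact_space (euclidean :: bool topology)"
    by (simp add: compact_space_def finite_imp_compact)
  then have "compact_space (euclidean :: (nat \<Rightarrow> nat \<Rightarrow> bool) topology)"
    by (intro compact_space_fun)
  then show ?thesis by (simp add: compact_space_def)
qed

lemma open_initial_bits_eq:
  "open {z :: nat \<Rightarrow> nat \<Rightarrow> bool. initial_bits n (z i) = initial_bits n x}"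
proof -
  have "open {z :: nat \<Rightarrow> nat \<Rightarrow> bool. z i j = x j}" for j
  proof -
    have "continuous_on UNIV (\<lambda>z :: nat \<Rightarrow> nat \<Rightarrow> bool. z i j)"
      by (rule continuous_on_product_then_coordinatewise[OF continuous_on_product_coordinates])
    then have "open ((\<lambda>z :: nat \<Rightarrow> nat \<Rightarrow> bool. z i j) -` {x j})"
      by (intro open_vimage open_discrete)
    then show ?thesis by (simp add: vimage_def)
  qed
  then have "open (\<Inter>j\<in>{..<n}. {z :: nat \<Rightarrow> nat \<Rightarrow> bool. z i j = x j})"
    by (intro open_INT) auto
  moreover have "(\<Inter>j\<in>{..<n}. {z. z i j = x j}) = {z. initial_bits n (z i) = initial_bits n x}"
    by (auto simp: initial_bits_eq_iff)
  ultimately show ?thesis by simp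
qed

text \<open>The rank bounds both the level and the size of the centre. A positive rank contains
  uncountably many balls, unlike a stage of a countable pi-base.\<close>

definition pr_balls :: "nat \<Rightarrow> (nat \<Rightarrow> bool) set set set" where
  "pr_balls m = {pr_ball k F | k F. k \<le> m \<and> finite F \<and> F \<noteq> {} \<and> card F \<le> m}"

lemma pr_ballsI:
  "\<lbrakk>k \<le> m; finite F; F \<noteq> {}; card F \<le> m\<rbrakk> \<Longrightarrow> pr_ball k F \<in> pr_balls m"
  unfolding pr_balls_def by blast

text \<open>\<open>A\<close> contains the tuple \<open>x\<close>, which meets the same cylinders of
  level \<open>n\<close> as \<open>F\<close>. So adding \<open>F\<close> to \<open>A\<close> gives
  no new cylinder of level \<open>n\<close>, and at the coarser level \<open>k\<close> both
  \<open>A\<close> and \<open>F\<close> agree with \<open>x\<close>.\<close>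

lemma pr_ball_refine:
  assumes F: "F = z ` {..m}" and FA: "A \<in> pr_ball k (x ` {..m})" and k: "k \<le> n"
    and eq: "\<And>i. i \<le> m \<Longrightarrow> initial_bits n (z i) = initial_bits n (x i)"
  shows "pr_ball n (F \<union> A) \<subseteq> pr_ball k F \<inter> pr_ball n A"
proof
  fix G assume G: "G \<in> pr_ball n (F \<union> A)"
  have Fx: "initial_bits n ` F = initial_bits n ` x ` {..m}"
    using eq unfolding F image_image by (intro image_cong) auto
  then have "initial_bits n ` F \<subseteq> initial_bits n ` A"
    using FA by (auto simp: pr_ball_def)
  then have *: "initial_bits n ` G = initial_bits n ` A"
    using G by (auto simp: pr_ball_def image_Un)
  have "initial_bits k ` G = initial_bits k ` F"
    using image_initial_bits_le[OF * k] image_initial_bits_le[OF Fx k] FA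
    by (simp add: pr_ball_def)
  with * G show "G \<in> pr_ball k F \<inter> pr_ball n A"
    by (simp add: pr_ball_def)
qed

text \<open>
  The centres with at most \<open>m + 1\<close> points are the tuples \<open>x ` {..m}\<close>. A ball \<open>pr_ball n A \<subseteq> D\<close> that
  serves one tuple also serves all tuples that agree with it up to level \<open>n\<close>, so that by compactness
  of the space of tuples finitely many balls suffice and their union is clopen.
\<close>
lemma dense_open_pr_balls:
  assumes D: "openin pixley_roy D" "pixley_roy closure_of D = topspace pixley_roy"
  shows "\<exists>M\<ge>m. \<exists>C. openin pixley_roy C \<and> closedin pixley_roy C \<and> C \<subseteq> D \<and>
           (\<forall>B\<in>pr_balls m. \<exists>B'\<in>pr_balls M. B' \<subseteq> B \<inter> C)"
proof -
  have "\<forall>x :: nat \<Rightarrow> nat \<Rightarrow> bool. \<forall>k. \<exists>A n. A \<in> pr_ball k (x ` {..m}) \<and> k \<le> n \<and> pr_ball n A \<subseteq> D"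
  proof (intro allI)
    fix x :: "nat \<Rightarrow> nat \<Rightarrow> bool" and k
    let ?F = "x ` {..m}"
    have ne: "?F \<noteq> {}" by auto
    have "?F \<in> pixley_roy closure_of D"
      by (auto simp: D topspace_pixley_roy)
    then obtain A where A: "A \<in> D" "A \<in> pr_ball k ?F"
      using openin_pr_ball[OF ne, of k] mem_pr_ball_self[of ?F k]
      unfolding in_closure_of by auto
    then obtain n where "pr_ball n A \<subseteq> D"
      using D(1) by (metis openin_pixley_royE)
    \<comment> \<open>The level is raised to at least \<open>k\<close>, as the refinement of balls
      requires.\<close>
    then have "pr_ball (max k n) A \<subseteq> D"
      using pr_ball_antimono[of n "max k n" A] by auto
    then show "\<exists>A n. A \<in> pr_ball k ?F \<and> k \<le> n \<and> pr_ball n A \<subseteq> D"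
      using A(2) max.cobounded1 by blast
  qed
  then obtain A n where A: "\<And>x k. A x k \<in> pr_ball k (x ` {..m})"
    and n: "\<And>x k. k \<le> n x k" and An: "\<And>x k. pr_ball (n x k) (A x k) \<subseteq> D"
    unfolding choice_iff by blast
  \<comment> \<open>One neighbourhood of \<open>x\<close> treats all levels \<open>k \<le> m\<close>
    and all entries up to \<open>m\<close> at once.\<close>
  define V where "V x = (\<Inter>(k,i)\<in>{..m}\<times>{..m}. {z :: nat \<Rightarrow> nat \<Rightarrow> bool.
      initial_bits (n x k) (z i) = initial_bits (n x k) (x i)})" for x
  have "open (V x)" for x
    unfolding V_def by (intro open_INT) (auto intro: open_initial_bits_eq)
  moreover have "UNIV \<subseteq> (\<Union>x. V x)" by (auto simp: V_def)
  ultimately obtain T where T: "finite T" "UNIV \<subseteq> (\<Union>x\<in>T. V x)"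
    using compactE_image[OF compact_UNIV_bool_sequences, of UNIV V] by auto
  define C where "C = (\<Union>(x,k)\<in>T\<times>{..m}. pr_ball (n x k) (A x k))"
  have A': "finite (A x k)" "A x k \<noteq> {}" for x k
    using A[of x k] by (auto simp: pr_ball_def)
  \<comment> \<open>Bounds both the level and the size of the refined centres
    \<open>F \<union> A x k\<close>, where \<open>F\<close> has at most \<open>m\<close>
    points.\<close>
  define M where "M = Suc (m + Max ((\<lambda>(x,k). n x k + card (A x k)) ` (T \<times> {..m})))"
  have M: "n x k + card (A x k) + m \<le> M" if "x \<in> T" "k \<le> m" for x k
  proof -
    have "n x k + card (A x k) \<le> Max ((\<lambda>(x,k). n x k + card (A x k)) ` (T \<times> {..m}))"
      using T(1) that by (intro Max_ge) auto
    then show ?thesis by (simp add: M_def)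
  qed
  have "\<exists>B'\<in>pr_balls M. B' \<subseteq> B \<inter> C" if mem: "B \<in> pr_balls m" for B
  proof -
    obtain k F where B: "B = pr_ball k F" "k \<le> m" "finite F" "F \<noteq> {}" "card F \<le> m"
      using mem unfolding pr_balls_def by blast
    obtain f where f: "F = f ` {..<card F}"
      using B(3) by (metis ex_bij_betw_nat_finite atLeast0LessThan bij_betw_imp_surj_on)
    \<comment> \<open>The tuple has \<open>m + 1\<close> entries but \<open>F\<close> has at most
      \<open>m\<close> points; surplus entries repeat \<open>f 0\<close>.\<close>
    define z where "z i = (if i < card F then f i else f 0)" for i
    have "0 < card F" using B by (simp add: card_gt_0_iff)
    then have "z ` {..m} = f ` {..<card F}"
      using B(5) by (force simp: z_def image_iff)
    then have z: "F = z ` {..m}" using f by simp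
    obtain x where x: "x \<in> T" "z \<in> V x" using T(2) by blast
    have eq: "initial_bits (n x k) (z i) = initial_bits (n x k) (x i)" if "i \<le> m" for i
      using x(2) that B(2) by (auto simp: V_def)
    have "pr_ball (n x k) (F \<union> A x k) \<subseteq> pr_ball k F \<inter> pr_ball (n x k) (A x k)"
      by (rule pr_ball_refine[OF z A n eq])
    also have "\<dots> \<subseteq> B \<inter> C"
      using B x(1) by (auto simp: C_def)
    finally have sub: "pr_ball (n x k) (F \<union> A x k) \<subseteq> B \<inter> C" .
    have "card (F \<union> A x k) \<le> M"
      using card_Un_le[of F "A x k"] B(5) M[OF x(1) B(2)] by linarith
    moreover have "n x k \<le> M" using M[OF x(1) B(2)] by linarith
    moreover have "finite (F \<union> A x k)" "F \<union> A x k \<noteq> {}" using B(3,4) A'(1) by simp_all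
    ultimately have "pr_ball (n x k) (F \<union> A x k) \<in> pr_balls M"
      by (intro pr_ballsI)
    then show ?thesis using sub by blast
  qed
  moreover have "openin pixley_roy C"
    unfolding C_def using A' by (auto intro!: openin_pr_ball)
  moreover have "closedin pixley_roy C"
    unfolding C_def using A' T(1) by (intro closedin_Union) (auto intro!: closedin_pr_ball)
  moreover have "C \<subseteq> D" using An by (auto simp: C_def)
  moreover have "m \<le> M" by (simp add: M_def)
  ultimately show ?thesis by blast
qed

text \<open>The base consists of finite intersections of clopen sets
  \<open>H D \<subseteq> D\<close>, for dense open \<open>D\<close>, assembled from the linked
  families chosen in each copy.\<close>

lemma ex_clopen_filter_base_pixley_roy:
  "\<exists>\<G>. clopen_filter_base (nat_copies pixley_roy) \<G>"
proof -
  let ?Z = "nat_copies pixley_roy"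
  define dns where "dns D \<longleftrightarrow> openin pixley_roy D \<and> pixley_roy closure_of D = topspace pixley_roy" for D
  define Dns where "Dns D \<longleftrightarrow> openin ?Z D \<and> ?Z closure_of D = topspace ?Z" for D
  have slice: "dns (Pair n -` D)" if D: "Dns D" for D n
  proof -
    have "topspace pixley_roy \<subseteq> pixley_roy closure_of (Pair n -` D)"
    proof
      fix y assume "y \<in> topspace pixley_roy"
      then have "(n, y) \<in> ?Z closure_of D" using D by (simp add: Dns_def)
      then show "y \<in> pixley_roy closure_of (Pair n -` D)" by (simp only: in_closure_of_nat_copies)
    qed
    then have "pixley_roy closure_of (Pair n -` D) = topspace pixley_roy"
      using closure_of_subset_topspace by (rule antisym[rotated])
    then show ?thesis
      using D unfolding dns_def Dns_def openin_nat_copies by blast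
  qed
  have "\<forall>n. \<exists>G. (\<forall>D. dns D \<longrightarrow> openin pixley_roy (G D) \<and> closedin pixley_roy (G D) \<and> G D \<subseteq> D) \<and>
      (\<forall>S. finite S \<and> card S \<le> n \<and> Ball S dns \<longrightarrow> (\<exists>i. \<exists>B\<in>pr_balls i. B \<subseteq> \<Inter>(G ` S)))"
  proof (intro allI n_linked_clopen_subsets)
    show "pr_balls i \<subseteq> pr_balls j" if "i \<le> j" for i j
      using that order_trans unfolding pr_balls_def by blast
    show "pr_ball 0 {undefined} \<in> pr_balls 1"
      by (intro pr_ballsI) auto
    show "\<exists>M\<ge>m. \<exists>C. openin pixley_roy C \<and> closedin pixley_roy C \<and> C \<subseteq> D \<and>
        (\<forall>B\<in>pr_balls m. \<exists>B'\<in>pr_balls M. B' \<subseteq> B \<inter> C)" if "dns D" for D m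
      using that unfolding dns_def by (intro dense_open_pr_balls) simp_all
  qed
  then obtain G where G:
    "\<And>n D. dns D \<Longrightarrow> openin pixley_roy (G n D) \<and> closedin pixley_roy (G n D) \<and> G n D \<subseteq> D"
    "\<And>n S. \<lbrakk>finite S; card S \<le> n; Ball S dns\<rbrakk> \<Longrightarrow> \<exists>i. \<exists>B\<in>pr_balls i. B \<subseteq> \<Inter>(G n ` S)"
    unfolding choice_iff by (elim exE) metis
  \<comment> \<open>In copy \<open>n\<close> any \<open>n\<close> of these sets meet, so that altogether they have the finite intersection property.\<close>
  define H where "H D = {(n, y). y \<in> G n (Pair n -` D)}" for D
  have H_slice: "Pair n -` H D = G n (Pair n -` D)" for n D by (auto simp: H_def)
  have H: "openin ?Z (H D)" "closedin ?Z (H D)" "H D \<subseteq> D" if "Dns D" for D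
  proof -
    show "openin ?Z (H D)" "closedin ?Z (H D)"
      using G(1) slice[OF that] by (auto simp: openin_nat_copies closedin_nat_copies H_slice)
    show "H D \<subseteq> D"
      using G(1) slice[OF that] by (fastforce simp: H_def)
  qed
  \<comment> \<open>Excluding the empty \<open>S\<close> keeps the intersections inside the space;
    unions of index sets give closure under intersection.\<close>
  define \<G> where "\<G> = {\<Inter>(H ` S) |S. finite S \<and> S \<noteq> {} \<and> Ball S Dns}"
  have "clopen_filter_base ?Z \<G>"
  proof
    fix U x assume Ux: "openin ?Z U" "x \<in> U"
    obtain n F where x: "x = (n, F)" by (cases x)
    have "openin pixley_roy (Pair n -` U)" "F \<in> Pair n -` U" using Ux x by (auto simp: openin_nat_copies)
    then obtain k where k: "finite F" "F \<noteq> {}" "pr_ball k F \<subseteq> Pair n -` U"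
      by (rule openin_pixley_royE)
    then show "\<exists>V. openin ?Z V \<and> closedin ?Z V \<and> x \<in> V \<and> V \<subseteq> U"
      using x openin_pr_ball[OF k(2)] closedin_pr_ball[OF k(1,2)] mem_pr_ball_self[OF k(1)]
      by (intro exI[of _ "{n} \<times> pr_ball k F"]) (auto simp: openin_prod_Times_iff closedin_prod_Times_iff)
  next
    show "Hausdorff_space ?Z"
      by (simp add: Hausdorff_space_prod_topology Hausdorff_pixley_roy)
  next
    have "Dns (topspace ?Z)"
      unfolding Dns_def by (rule conjI[OF openin_topspace closure_of_topspace])
    then have "\<Inter>(H ` {topspace ?Z}) \<in> \<G>" unfolding \<G>_def by blast
    then show "\<G> \<noteq> {}" by blast
  next
    fix g h assume "g \<in> \<G>" "h \<in> \<G>"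
    then obtain S T where "g = \<Inter>(H ` S)" "finite S" "S \<noteq> {}" "Ball S Dns"
      "h = \<Inter>(H ` T)" "finite T" "T \<noteq> {}" "Ball T Dns"
      unfolding \<G>_def mem_Collect_eq by (elim exE conjE)
    then have "g \<inter> h = \<Inter>(H ` (S \<union> T))" "finite (S \<union> T)" "S \<union> T \<noteq> {}" "Ball (S \<union> T) Dns" by auto
    then show "g \<inter> h \<in> \<G>" unfolding \<G>_def by blast
  next
    fix g assume "g \<in> \<G>"
    then obtain S where S: "g = \<Inter>(H ` S)" "finite S" "S \<noteq> {}" "Ball S Dns"
      unfolding \<G>_def by blast
    have "openin ?Z g" unfolding S(1) using S H by (intro openin_Inter) auto
    moreover have "closedin ?Z g" unfolding S(1) using S H by (intro closedin_Inter) auto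
    moreover have "g \<noteq> {}"
    proof -
      define n where "n = card S"
      have "\<exists>i. \<exists>B\<in>pr_balls i. B \<subseteq> \<Inter>(G n ` (\<lambda>D. Pair n -` D) ` S)"
        using S slice by (intro G(2)) (auto simp: n_def card_image_le)
      then obtain i B where "B \<in> pr_balls i" "B \<subseteq> \<Inter>(G n ` (\<lambda>D. Pair n -` D) ` S)" by blast
      moreover from this(1) obtain y where "y \<in> B"
        unfolding pr_balls_def using mem_pr_ball_self by blast
      ultimately have "(n, y) \<in> g" by (auto simp: S(1) H_def)
      then show ?thesis by blast
    qed
    ultimately show "openin ?Z g \<and> closedin ?Z g \<and> g \<noteq> {}" by blast
  next
    fix D assume "openin ?Z D" "?Z closure_of D = topspace ?Z"
    then have "Dns D" by (simp add: Dns_def)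
    then have "\<Inter>(H ` {D}) \<in> \<G>" "\<Inter>(H ` {D}) \<subseteq> D" unfolding \<G>_def using H(3) by blast+
    then show "\<exists>g\<in>\<G>. g \<subseteq> D" by blast
  next
    fix x assume x: "x \<in> topspace ?Z"
    obtain n F where nF: "x = (n, F)" by (cases x)
    \<comment> \<open>An isolated point would be a countable set whose closure has nonempty
      interior.\<close>
    show "\<not> openin ?Z {x}"
    proof
      assume "openin ?Z {x}"
      then have "openin pixley_roy (Pair n -` {x})" unfolding openin_nat_copies by blast
      then have "openin pixley_roy {F}" by (simp add: nF vimage_def)
      moreover have "{F} \<subseteq> pixley_roy closure_of {F}"
        using x nF by (intro closure_of_subset) auto
      ultimately have "F \<in> pixley_roy interior_of (pixley_roy closure_of {F})"
        by (auto simp: interior_of_def)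
      then show False
        using countable_pixley_roy_interior_of_closure_of[of "{F}"] x nF by auto
    qed
  qed
  then show ?thesis by blast
qed

section \<open>Coding the points of the extension as sets of sets of reals\<close>

lemma ex_inj_into_real_set_set:
  "\<exists>e :: (nat \<times> (nat \<Rightarrow> bool) set) option \<Rightarrow> real set set. inj e"
proof -
  define f :: "(nat \<Rightarrow> bool) \<Rightarrow> real set" where "f x = real ` Collect x" for x
  \<comment> \<open>Negative numbers keep the tag \<open>t n\<close> apart from the coded points.\<close>
  define t :: "nat \<Rightarrow> real set" where "t n = {- real n - 1}" for n
  \<comment> \<open>The tag makes every code of a pair nonempty, which reserves \<open>{}\<close>
    for \<open>None\<close>.\<close>
  define e where "e p = (case p of None \<Rightarrow> {} | Some (n, F) \<Rightarrow> insert (t n) (f ` F))"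
    for p :: "(nat \<times> (nat \<Rightarrow> bool) set) option"
  have f: "inj f"
    by (rule injI) (auto simp: f_def inj_image_eq_iff)
  have t: "t n \<notin> range f" for n
  proof
    assume "t n \<in> range f"
    then have "- real n - 1 \<in> range real" by (auto simp: t_def f_def)
    then show False by auto
  qed
  have t_eq: "t m = t n \<longleftrightarrow> m = n" for m n by (simp add: t_def)
  have "p = q" if pq: "e p = e q" for p q
  proof (cases p; cases q)
    fix a b assume ab: "p = Some a" "q = Some b"
    obtain m F n H where FH: "a = (m, F)" "b = (n, H)" by fastforce
    have eq: "insert (t m) (f ` F) = insert (t n) (f ` H)"
      using pq ab FH by (simp add: e_def)
    then have "t m = t n" using t by blast
    \<comment> \<open>Intersecting with \<open>range f\<close> strips the tag.\<close>
    moreover have "insert (t m) (f ` F) \<inter> range f = f ` F" "insert (t n) (f ` H) \<inter> range f = f ` H"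
      using t by auto
    then have "f ` F = f ` H" using eq by simp
    then have "F = H" using f by (simp add: inj_image_eq_iff)
    ultimately show "p = q" using ab FH t_eq by simp
  qed (use pq in \<open>auto simp: e_def split: prod.splits\<close>)
  then show ?thesis by (auto simp: inj_def)
qed

(* HOL cannot quantify existentially over types, so the points of the space are drawn
   from a fixed type of cardinality 2^(2^c); topspace X may be any subset of it. *)
theorem mainTheorem6:
  shows "\<exists>X :: real set set topology.
           Tychonoff_space X \<and> ccc_tight X \<and> \<not> Lindelof_tight X"
proof -
  let ?Z = "nat_copies pixley_roy"
  obtain \<G> where "clopen_filter_base ?Z \<G>"
    using ex_clopen_filter_base_pixley_roy by blast
  then interpret clopen_filter_base ?Z \<G> .
  have "ccc_tight (one_point_extension ?Z \<G>)"
  proof (rule ccc_tight_ext)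
    show "ccc_space ?Z" by (intro ccc_nat_copies ccc_pixley_roy)
    fix A x assume xA: "x \<in> ?Z closure_of A"
    obtain n F where x: "x = (n, F)" by (cases x)
    have "F \<in> pixley_roy closure_of (Pair n -` A)"
      using xA unfolding x by (simp only: in_closure_of_nat_copies)
    then obtain B where B: "B \<subseteq> Pair n -` A" "countable B" "F \<in> pixley_roy closure_of B"
      by (metis countable_tight_pixley_roy)
    then have "x \<in> ?Z closure_of (Pair n ` B)"
      by (simp add: x in_closure_of_nat_copies inj_vimage_image_eq inj_on_def)
    then show "\<exists>B\<subseteq>A. countable B \<and> x \<in> ?Z closure_of B"
      using B by (intro exI[of _ "Pair n ` B"]) auto
  qed
  moreover have "\<not> Lindelof_tight (one_point_extension ?Z \<G>)"
  proof (rule not_Lindelof_tight_ext)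
    fix L assume L: "L \<subseteq> topspace ?Z" "Lindelof_space (subtopology ?Z L)"
    show "?Z interior_of (?Z closure_of L) = {}"
    \<comment> \<open>Each slice of \<open>L\<close> is Lindelof, hence countable, hence nowhere
      dense in its copy.\<close>
    proof (intro nat_copies_nowhere_dense countable_pixley_roy_interior_of_closure_of)
      fix n
      show "Pair n -` L \<subseteq> topspace pixley_roy" using L(1) by auto
      then show "countable (Pair n -` L)"
        using Lindelof_space_nat_copies_slice[OF L] by (rule Lindelof_pixley_roy_countable)
    qed
  qed
  ultimately show ?thesis
    using ex_inj_into_real_set_set ex_space_on_larger_type[OF _ Tychonoff_ext] by blast
qed

end
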